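(* Let $I\times J=[a,b]\times[c,d]\subset\mathbb{R}^2$, let $M,N\in\mathbb{N}\cup\{0\}$, let $P:I\times J\to\mathbb{R}$ be an integrable function and let $f\in C^{(M+1,N+1)}(I\times J)$ be $(M+1,N+1)$-$\nabla$-convex on $I\times J$. Let $\Lambda(h)=\int_a^b\int_c^d P(y,z)h(y,z)\,dz\,dy$ and suppose that $$\int_a^b\int_c^d P(y,z)\frac{(b-y)^i}{i!}\frac{(d-z)^j}{j!}\,dz\,dy=0,\quad i\in\{0,\ldots,M\},\ j\in\{0,\ldots,N\};$$ $$\int_a^s\int_c^d P(y,z)\frac{(s-y)^M}{M!}\frac{(d-z)^j}{j!}\,dz\,dy=0,\quad j\in\{0,\ldots,N\},\ \forall s\in[a,b];$$ $$\int_a^b\int_c^t P(y,z)\frac{(b-y)^i}{i!}\frac{(t-z)^N}{N!}\,dz\,dy=0,\quad i\in\{0,\ldots,M\},\ \forall t\in[c,d];$$ $$\int_a^s\int_c^t P(y,z)\frac{(s-y)^M}{M!}\frac{(t-z)^N}{N!}\,dz\,dy\ge 0,\quad \forall s\in[a,b],\ \forall t\in[c,d].$$ Then there exists $(\eta,\zeta)\in I\times J$ such that $$\Lambda(f)=(-1)^{M+N}\,\Lambda(G_0)\,f_{(M+1,N+1)}(\eta,\zeta),$$ where $G_0(y,z)=(-1)^{M+N}\dfrac{y^{M+1}}{(M+1)!}\dfrac{z^{N+1}}{(N+1)!}$.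
   Context: $f_{(i,j)}=\dfrac{\partial^{i+j}f}{\partial y^i\partial z^j}$; $(\cdot)^0=1$. $C^{(M+1,N+1)}(I\times J)$ denotes the functions with continuous partial derivatives $f_{(i,j)}$ for $0\le i\le M+1$, $0\le j\le N+1$. One-variable divided differences at distinct points: $[x_j;g]=g(x_j)$, $[x_i,\ldots,x_{i+l};g]=\dfrac{[x_{i+1},\ldots,x_{i+l};g]-[x_i,\ldots,x_{i+l-1};g]}{x_{i+l}-x_i}$. A function $f:I\times J\to\mathbb{R}$ is $(m,n)$-$\nabla$-convex if $(-1)^{m+n}[y_i,\ldots,y_{i+m};[z_j,\ldots,z_{j+n};f]]\ge 0$ for all distinct points $y_i,\ldots,y_{i+m}\in I$ and distinct $z_j,\ldots,z_{j+n}\in J$; for $f\in C^{(m,n)}(I\times J)$ this is equivalent to $(-1)^{m+n}f_{(m,n)}\ge 0$ on $I\times J$. *)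

theory Defs
  imports "HOL-Analysis.Analysis"
begin

text \<open>\<open>partial_deriv I J f i j\<close> is $f_{(i,j)} = \partial^{i+j} f / \partial y^i \partial z^j$: first
  \<open>j\<close> derivatives in the second variable, then \<open>i\<close> in the first.  Derivatives are taken within
  \<open>I\<close> and \<open>J\<close>, hence are one-sided at the end points, and only depend on the values
  of \<open>f\<close> on \<open>I \<times> J\<close>.\<close>

definition deriv_fst :: "real set \<Rightarrow> (real \<Rightarrow> real \<Rightarrow> real) \<Rightarrow> real \<Rightarrow> real \<Rightarrow> real" where
  "deriv_fst I f y z = vector_derivative (\<lambda>u. f u z) (at y within I)"

definition deriv_snd :: "real set \<Rightarrow> (real \<Rightarrow> real \<Rightarrow> real) \<Rightarrow> real \<Rightarrow> real \<Rightarrow> real" where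
  "deriv_snd J f y z = vector_derivative (\<lambda>v. f y v) (at z within J)"

definition partial_deriv ::
    "real set \<Rightarrow> real set \<Rightarrow> (real \<Rightarrow> real \<Rightarrow> real) \<Rightarrow> nat \<Rightarrow> nat \<Rightarrow> real \<Rightarrow> real \<Rightarrow> real" where
  "partial_deriv I J f i j = (deriv_fst I ^^ i) ((deriv_snd J ^^ j) f)"

text \<open>Since \<open>vector_derivative\<close> is total, the existence of each $f_{(i,j)}$ with \<open>i \<le> m\<close>,
  \<open>j \<le> n\<close> is required separately from its continuity.\<close>

definition C_class :: "nat \<Rightarrow> nat \<Rightarrow> real set \<Rightarrow> real set \<Rightarrow> (real \<Rightarrow> real \<Rightarrow> real) \<Rightarrow> bool" where
  "C_class m n I J f \<longleftrightarrow>
     (\<forall>j<n. \<forall>y\<in>I. \<forall>z\<in>J.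
        (\<lambda>v. partial_deriv I J f 0 j y v) differentiable (at z within J)) \<and>
     (\<forall>i<m. \<forall>j\<le>n. \<forall>y\<in>I. \<forall>z\<in>J.
        (\<lambda>u. partial_deriv I J f i j u z) differentiable (at y within I)) \<and>
     (\<forall>i\<le>m. \<forall>j\<le>n. continuous_on (I \<times> J) (\<lambda>(y, z). partial_deriv I J f i j y z))"

text \<open>\<open>divided_diff x i l g\<close> is $[x_i, \ldots, x_{i+l}; g]$.\<close>

fun divided_diff :: "(nat \<Rightarrow> real) \<Rightarrow> nat \<Rightarrow> nat \<Rightarrow> (real \<Rightarrow> real) \<Rightarrow> real" where
  "divided_diff x i 0 g = g (x i)"
| "divided_diff x i (Suc l) g =
     (divided_diff x (Suc i) l g - divided_diff x i l g) / (x (i + Suc l) - x i)"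

definition nabla_convex :: "nat \<Rightarrow> nat \<Rightarrow> real set \<Rightarrow> real set \<Rightarrow> (real \<Rightarrow> real \<Rightarrow> real) \<Rightarrow> bool" where
  "nabla_convex m n I J f \<longleftrightarrow>
     (\<forall>y z i j.
        y ` {i..i + m} \<subseteq> I \<and> inj_on y {i..i + m} \<and>
        z ` {j..j + n} \<subseteq> J \<and> inj_on z {j..j + n} \<longrightarrow>
        (-1) ^ (m + n) * divided_diff y i m (\<lambda>u. divided_diff z j n (\<lambda>v. f u v)) \<ge> 0)"

text \<open>The iterated Lebesgue integral $\int_a^b \int_c^d h(y,z)\,dz\,dy$, for $a \le b$ and $c \le d$.\<close>

definition iter_integral ::
    "real \<Rightarrow> real \<Rightarrow> real \<Rightarrow> real \<Rightarrow> (real \<Rightarrow> real \<Rightarrow> real) \<Rightarrow> real" where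
  "iter_integral a b c d h = (LINT y:{a..b}|lebesgue. (LINT z:{c..d}|lebesgue. h y z))"

definition Lambda ::
    "real \<Rightarrow> real \<Rightarrow> real \<Rightarrow> real \<Rightarrow> (real \<Rightarrow> real \<Rightarrow> real) \<Rightarrow> (real \<Rightarrow> real \<Rightarrow> real) \<Rightarrow> real" where
  "Lambda a b c d P h = iter_integral a b c d (\<lambda>y z. P y z * h y z)"

definition G0 :: "nat \<Rightarrow> nat \<Rightarrow> real \<Rightarrow> real \<Rightarrow> real" where
  "G0 M N y z = (-1) ^ (M + N) * (y ^ (M + 1) / fact (M + 1)) * (z ^ (N + 1) / fact (N + 1))"

end

theory Submission
  imports Defs
begin

text \<open>Taylor expansion of \<open>f\<close> at \<open>d\<close> in the second variable and then at \<open>b\<close> in the first,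
  followed by an interchange of integrals, writes $\Lambda(f)$ as a sum of moments of \<open>P\<close> that all
  vanish by assumption, plus $(-1)^{M+N} \int_c^d \int_a^b K(s,t) f_{(M+1,N+1)}(s,t)\,ds\,dt$, where
  $K(s,t) = \int_a^s \int_c^t P(y,z) \frac{(s-y)^M}{M!} \frac{(t-z)^N}{N!}\,dz\,dy \ge 0$.
  The case $f = G_0$ identifies $\int\int K$ as $\Lambda(G_0)$, and the mean value theorem for the
  nonnegative weight \<open>K\<close> gives $(\eta,\zeta)$.\<close>

text \<open>The hypotheses are iterated integrals over rectangles that move with s and t. Two
  devices turn all of them into integrals over the whole plane, with s and t occurring only in the
  integrand: a Borel density \<open>p\<close> that vanishes off the rectangle, and truncated powers
  in place of powers on [a,s] and [c,t]. Each Taylor expansion is then a one-variable formula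
  averaged against \<open>p\<close>, and the only interchange needed is between a point x of the
  plane and one real parameter. The expansions are made at the right end points because the weights
  in the hypotheses are powers of b-y and d-z. The remainders then carry the signs (-1)^(N+1) and
  (-1)^(M+1), whose product is (-1)^(M+N). Each variable contributes a polynomial part and a
  remainder; the four families of hypotheses are the four products of such parts, and only remainder
  times remainder survives.\<close>

section \<open>From iterated Lebesgue integrals to a Borel density on the plane\<close>

text \<open>Completeness of \<open>lebesgue\<close> makes \<open>f\<close> measurable. This allows
  its use for an \<open>f\<close> that is itself an inner Lebesgue integral, about whose
  measurability nothing is known beforehand.\<close>

lemma integral_lebesgue_AE_borel:
  fixes f g :: "'a::euclidean_space \<Rightarrow> real"
  assumes "g \<in> borel_measurable lborel" and "AE x in lborel. f x = g x"
  shows "(LINT x|lebesgue. f x) = (LINT x|lborel. g x)"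
proof -
  have g: "g \<in> borel_measurable lebesgue"
    using assms(1) by (rule measurable_completion)
  have ae: "AE x in lebesgue. g x = f x"
    using AE_completion[OF assms(2)] by (simp add: eq_commute)
  have f: "f \<in> borel_measurable lebesgue"
    using borel_measurable_AE[OF g ae] .
  have "(LINT x|lebesgue. f x) = (LINT x|lebesgue. g x)"
    using ae by (intro integral_cong_AE f g) (simp add: eq_commute)
  also have "\<dots> = (LINT x|lborel. g x)"
    using assms(1) by (rule integral_completion)
  finally show ?thesis .
qed

lemma fst_snd_borel_measurable [measurable, simp]:
  "fst \<in> borel_measurable (borel :: (real \<times> real) measure)"
  "snd \<in> borel_measurable (borel :: (real \<times> real) measure)"
  by (auto intro!: borel_measurable_continuous_onI continuous_intros)

text \<open>The bound is asked only where \<open>p\<close> is nonzero because weights such as powers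
  of b-y are unbounded on the plane, while \<open>p\<close> lives on a compact rectangle.\<close>

lemma integrable_mult_bounded_on_support:
  fixes p w :: "'a \<Rightarrow> real"
  assumes p: "integrable M p" and [measurable]: "w \<in> borel_measurable M"
    and w: "\<And>x. p x \<noteq> 0 \<Longrightarrow> \<bar>w x\<bar> \<le> B"
  shows "integrable M (\<lambda>x. p x * w x)"
proof (rule Bochner_Integration.integrable_bound)
  show "integrable M (\<lambda>x. B * p x)" using p by simp
  have [measurable]: "p \<in> borel_measurable M" using p by simp
  show "(\<lambda>x. p x * w x) \<in> borel_measurable M" by measurable
  have "\<bar>p x * w x\<bar> \<le> \<bar>B * p x\<bar>" for x
  proof (cases "p x = 0")
    case False
    have "\<bar>w x\<bar> * \<bar>p x\<bar> \<le> \<bar>B\<bar> * \<bar>p x\<bar>"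
      using w[OF False] by (intro mult_right_mono) auto
    then show ?thesis by (simp add: abs_mult mult.commute)
  qed simp
  then show "AE x in M. norm (p x * w x) \<le> norm (B * p x)" by simp
qed

text \<open>\<open>P\<close> is only Lebesgue measurable, so its sections need not be measurable and Fubini does not
  apply to it directly; a Borel version of \<open>P\<close> gives the same iterated integrals.\<close>

lemma iter_integral_borel_density:
  fixes P :: "real \<Rightarrow> real \<Rightarrow> real"
  assumes P: "set_integrable lebesgue ({a..b} \<times> {c..d}) (\<lambda>(y, z). P y z)"
  obtains p :: "real \<times> real \<Rightarrow> real" where "integrable lborel p"
    and "\<And>x. x \<notin> {a..b} \<times> {c..d} \<Longrightarrow> p x = 0"
    and "\<And>h s t. continuous_on ({a..b} \<times> {c..d}) h \<Longrightarrow> s \<in> {a..b} \<Longrightarrow> t \<in> {c..d} \<Longrightarrow>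
      iter_integral a s c t (\<lambda>y z. P y z * h (y, z)) =
        (LINT x|lborel. p x * (indicator ({a..s} \<times> {c..t}) x * h x))"
proof -
  define R where "R = {a..b} \<times> {c..d}"
  define q where "q x = indicator R x * P (fst x) (snd x)" for x
  have "closed R" unfolding R_def by (intro closed_Times) auto
  then have [measurable]: "R \<in> sets borel" by simp
  have q: "integrable lebesgue q"
    using P unfolding set_integrable_def R_def[symmetric] q_def case_prod_beta by simp
  then have "q \<in> borel_measurable (completion lborel)" by (rule borel_measurable_integrable)
  then obtain p' where p'[measurable]: "p' \<in> borel_measurable lborel"
    and qp': "AE x in lborel. q x = p' x"
    using completion_ex_borel_measurable_real by blast
  \<comment> \<open>Cutting off by \<open>R\<close> makes the support condition hold everywhere and
    not just almost everywhere; later arguments use it pointwise.\<close>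
  define p where "p x = indicator R x * p' x" for x
  have p[measurable]: "p \<in> borel_measurable lborel" unfolding p_def by measurable
  have qp: "AE x in lborel. q x = p x"
    using qp' by eventually_elim (auto simp: p_def q_def indicator_def)
  have "integrable lebesgue p"
    using AE_completion[OF qp] measurable_completion[OF p]
    by (intro integrable_cong_AE_imp[OF q]) (auto simp: eq_commute)
  then have int_p: "integrable lborel p" using integrable_completion[OF p] by simp
  have eq: "iter_integral a s c t (\<lambda>y z. P y z * h (y, z)) =
        (LINT x|lborel. p x * (indicator ({a..s} \<times> {c..t}) x * h x))"
    if h: "continuous_on R h" and s: "s \<in> {a..b}" and t: "t \<in> {c..d}" for h s t
  proof -
    have "compact R" unfolding R_def by (intro compact_Times) auto
    then have "compact (h ` R)" using h by (rule compact_continuous_image[rotated])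
    then obtain B where B: "\<And>x. x \<in> R \<Longrightarrow> \<bar>h x\<bar> \<le> B"
      using compact_imp_bounded[of "h ` R"] unfolding bounded_iff by auto
    have hR[measurable]: "(\<lambda>x. indicator R x * h x) \<in> borel_measurable borel"
      using borel_measurable_continuous_on_indicator[OF _ h] by simp
    define S where "S = {a..s} \<times> {c..t}"
    have SR: "S \<subseteq> R" unfolding S_def R_def using s t by auto
    have "closed S" unfolding S_def by (intro closed_Times) auto
    then have [measurable]: "S \<in> sets borel" by simp
    \<comment> \<open>Continuity of \<open>h\<close> on \<open>R\<close> gives measurability only
      after multiplication by \<open>indicator R\<close>; since \<open>S\<close> lies in
      \<open>R\<close>, this factor does not change the product.\<close>
    define H where "H x = indicator S x * (indicator R x * h x)" for x
    have H[measurable]: "H \<in> borel_measurable borel" unfolding H_def by measurable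
    have H_eq: "H x = indicator S x * h x" for x
      using SR by (auto simp: H_def indicator_def)
    have "\<bar>H x\<bar> \<le> B" if "p x \<noteq> 0" for x
      using B[of x] that SR by (auto simp: H_eq p_def indicator_def split: if_splits)
    then have int: "integrable lborel (\<lambda>x. p x * H x)"
      by (intro integrable_mult_bounded_on_support[OF int_p]) auto
    then have int2: "integrable (lborel \<Otimes>\<^sub>M lborel) (\<lambda>x. p x * H x)"
      by (simp add: lborel_prod)
    have "AE x in lborel \<Otimes>\<^sub>M lborel. q x = p x"
      using qp unfolding lborel_prod .
    then have ae: "AE y in lborel. AE z in lborel. q (y, z) = p (y, z)"
      by (rule lborel_pair.AE_pair)
    have pH: "(\<lambda>x. p x * H x) \<in> borel_measurable (lborel \<Otimes>\<^sub>M lborel)"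
      using int2 by (rule borel_measurable_integrable)
    have inner: "indicator {a..s} y * (LINT z:{c..t}|lebesgue. P y z * h (y, z)) =
        (LINT z|lebesgue. q (y, z) * H (y, z))" for y
      unfolding set_lebesgue_integral_def integral_mult_right_zero[symmetric]
      by (intro Bochner_Integration.integral_cong refl)
        (use s t in \<open>auto simp: q_def H_eq S_def R_def indicator_def\<close>)
    have "iter_integral a s c t (\<lambda>y z. P y z * h (y, z)) =
        (LINT y|lebesgue. (LINT z|lebesgue. q (y, z) * H (y, z)))"
      unfolding iter_integral_def set_lebesgue_integral_def[of _ "{a..s}"] inner[symmetric] by simp
    \<comment> \<open>Sections of \<open>q\<close> and \<open>p\<close> agree almost everywhere only
      for almost every y. So the passage to Borel functions is made twice: on the inner integral for
      those y, then on the outer one.\<close>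
    also have "\<dots> = (LINT y|lborel. (LINT z|lborel. p (y, z) * H (y, z)))"
    proof (rule integral_lebesgue_AE_borel)
      show "(\<lambda>y. LINT z|lborel. p (y, z) * H (y, z)) \<in> borel_measurable lborel"
        using pH by (intro lborel.borel_measurable_lebesgue_integral) (simp add: case_prod_beta)
      show "AE y in lborel. (LINT z|lebesgue. q (y, z) * H (y, z)) =
          (LINT z|lborel. p (y, z) * H (y, z))"
        using ae
      proof eventually_elim
        case (elim y)
        show ?case
        proof (rule integral_lebesgue_AE_borel)
          show "(\<lambda>z. p (y, z) * H (y, z)) \<in> borel_measurable lborel"
            using measurable_compose[OF measurable_Pair1' pH, of y] by simp
        qed (use elim in eventually_elim, simp)
      qed
    qed
    also have "\<dots> = (LINT x|(lborel \<Otimes>\<^sub>M lborel). p x * H x)"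
      using lborel_pair.integral_fst'[OF int2] by simp
    also have "\<dots> = (LINT x|lborel. p x * (indicator S x * h x))"
      by (simp add: lborel_prod H_eq)
    finally show ?thesis by (simp add: S_def)
  qed
  show ?thesis
    by (rule that[OF int_p]) (use eq in \<open>auto simp: p_def R_def\<close>)
qed

section \<open>Truncated powers and the averaged one-variable Taylor formula\<close>

text \<open>The Peano kernel (t-y)_+^n / n!. For n = 0 it is the indicator of
  \<open>y \<le> t\<close>, with value 1 at y = t, which agrees with the closed domains of
  integration [a,s] and [c,t].\<close>

definition trunc_pow :: "nat \<Rightarrow> real \<Rightarrow> real \<Rightarrow> real" where
  "trunc_pow n y t = (if y \<le> t then (t - y) ^ n / fact n else 0)"

lemma trunc_pow_measurable [measurable]:
  assumes [measurable]: "f \<in> borel_measurable M" "g \<in> borel_measurable M"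
  shows "(\<lambda>x. trunc_pow n (f x) (g x)) \<in> borel_measurable M"
  unfolding trunc_pow_def by measurable

lemma abs_trunc_pow_le:
  assumes "y \<in> {\<alpha>..\<beta>}" "t \<in> {\<alpha>..\<beta>}"
  shows "\<bar>trunc_pow n y t\<bar> \<le> (\<beta> - \<alpha>) ^ n / fact n"
  using assms by (auto simp: trunc_pow_def abs_mult intro!: divide_right_mono power_mono)

text \<open>Taylor's formula at the right end point with integral remainder. The truncated power
  lets the remainder run over an interval independent of y, as the later interchange of integrals
  requires.\<close>

lemma taylor_trunc_pow:
  fixes g :: "nat \<Rightarrow> real \<Rightarrow> real"
  assumes g: "\<And>j t. j \<le> n \<Longrightarrow> t \<in> {\<alpha>..\<beta>} \<Longrightarrow>
      (g j has_vector_derivative g (Suc j) t) (at t within {\<alpha>..\<beta>})"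
    and cont: "continuous_on {\<alpha>..\<beta>} (g (Suc n))" and y: "y \<in> {\<alpha>..\<beta>}"
  shows "g 0 y = (\<Sum>j\<le>n. (-1) ^ j * ((\<beta> - y) ^ j / fact j * g j \<beta>)) +
    (-1) ^ Suc n * (LINT t|lborel. indicator {\<alpha>..\<beta>} t * (trunc_pow n y t * g (Suc n) t))"
proof -
  \<comment> \<open>\<open>Taylor_has_integral\<close> expands at the left end point, so it is
    applied to the reflected function on [-\<beta>,-y]; every derivative of the reflection
    contributes a factor -1.\<close>
  define D where "D j x = (-1) ^ j * g j (- x)" for j x
  define r where "r t = (t - y) ^ n / fact n * ((-1) ^ Suc n * g (Suc n) t)" for t
  have D: "(D j has_vector_derivative D (Suc j) x) (at x within {-\<beta>..-y})"
    if "j < Suc n" "- \<beta> \<le> x" "x \<le> - y" for j x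
  proof -
    have "(g j has_vector_derivative g (Suc j) (- x)) (at (- x) within uminus ` {-\<beta>..-y})"
      using g[of j "- x"] that y by (auto intro: has_vector_derivative_within_subset)
    then have "(g j \<circ> uminus has_vector_derivative (- 1) *\<^sub>R g (Suc j) (- x)) (at x within {-\<beta>..-y})"
      by (intro vector_diff_chain_within) (auto intro!: derivative_eq_intros)
    then have "((\<lambda>x. (-1) ^ j * (g j \<circ> uminus) x) has_vector_derivative
        (-1) ^ j * ((- 1) *\<^sub>R g (Suc j) (- x))) (at x within {-\<beta>..-y})"
      by (rule has_vector_derivative_mult_right)
    then show ?thesis by (simp add: D_def[abs_def] o_def)
  qed
  have "((\<lambda>x. ((- y - x) ^ (Suc n - 1) / fact (Suc n - 1)) *\<^sub>R D (Suc n) x) has_integral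
      D 0 (- y) - (\<Sum>j<Suc n. ((- y - (- \<beta>)) ^ j / fact j) *\<^sub>R D j (- \<beta>))) {-\<beta>..-y}"
    by (rule Taylor_has_integral[where Df = D]) (use y D in auto)
  then have "((\<lambda>x. r (- x)) has_integral
      g 0 y - (\<Sum>j\<le>n. (-1) ^ j * ((\<beta> - y) ^ j / fact j * g j \<beta>))) {-\<beta>..-y}"
    by (simp add: D_def r_def lessThan_Suc_atMost minus_diff_commute mult_ac)
  then have hi: "(r has_integral
      g 0 y - (\<Sum>j\<le>n. (-1) ^ j * ((\<beta> - y) ^ j / fact j * g j \<beta>))) {y..\<beta>}"
    by (simp only: has_integral_reflect_real)
  have "continuous_on {y..\<beta>} (g (Suc n))"
    using cont by (rule continuous_on_subset) (use y in auto)
  then have "continuous_on {y..\<beta>} r"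
    unfolding r_def by (intro continuous_intros) auto
  then have "(LINT t:{y..\<beta>}|lborel. r t) = integral {y..\<beta>} r"
    by (intro set_borel_integral_eq_integral borel_integrable_atLeastAtMost')
  also have "\<dots> = g 0 y - (\<Sum>j\<le>n. (-1) ^ j * ((\<beta> - y) ^ j / fact j * g j \<beta>))"
    using hi by (rule integral_unique)
  finally have "(LINT t:{y..\<beta>}|lborel. r t) = \<dots>" .
  moreover have "(LINT t:{y..\<beta>}|lborel. r t) =
      (-1) ^ Suc n * (LINT t|lborel. indicator {\<alpha>..\<beta>} t * (trunc_pow n y t * g (Suc n) t))"
    unfolding set_lebesgue_integral_def integral_mult_right_zero[symmetric]
    by (intro Bochner_Integration.integral_cong refl)
      (use y in \<open>auto simp: r_def trunc_pow_def indicator_def\<close>)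
  ultimately show ?thesis by simp
qed

text \<open>Taylor's formula in the coordinate \<open>\<pi> x\<close>, with x also acting as a
  parameter of the expanded function, is integrated against \<open>p\<close>. Fubini then moves the
  remainder variable t outside. Leaving \<open>\<pi>\<close> general covers both coordinates of the
  plane.\<close>

lemma integral_taylor_trunc_pow:
  fixes p \<pi> :: "'a::euclidean_space \<Rightarrow> real" and u :: "nat \<Rightarrow> 'a \<Rightarrow> real \<Rightarrow> real"
  assumes p: "integrable lborel p" and \<pi>[measurable]: "\<pi> \<in> borel_measurable lborel"
    and supp: "\<And>x. p x \<noteq> 0 \<Longrightarrow> \<pi> x \<in> {\<alpha>..\<beta>}"
    and deriv: "\<And>x j t. p x \<noteq> 0 \<Longrightarrow> j \<le> n \<Longrightarrow> t \<in> {\<alpha>..\<beta>} \<Longrightarrow>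
      (u j x has_vector_derivative u (Suc j) x t) (at t within {\<alpha>..\<beta>})"
    and cont: "\<And>x. p x \<noteq> 0 \<Longrightarrow> continuous_on {\<alpha>..\<beta>} (u (Suc n) x)"
    and meas: "\<And>j. j \<le> Suc n \<Longrightarrow> (\<lambda>(x, t). u j x t) \<in> borel_measurable (lborel \<Otimes>\<^sub>M lborel)"
    and bnd: "\<And>x j t. p x \<noteq> 0 \<Longrightarrow> j \<le> Suc n \<Longrightarrow> t \<in> {\<alpha>..\<beta>} \<Longrightarrow> \<bar>u j x t\<bar> \<le> B"
  shows "(LINT x|lborel. p x * u 0 x (\<pi> x)) =
    (\<Sum>j\<le>n. (-1) ^ j * (LINT x|lborel. p x * ((\<beta> - \<pi> x) ^ j / fact j * u j x \<beta>))) +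
    (-1) ^ Suc n * (LINT t|lborel. indicator {\<alpha>..\<beta>} t *
      (LINT x|lborel. p x * (trunc_pow n (\<pi> x) t * u (Suc n) x t)))"
proof -
  have [measurable]: "p \<in> borel_measurable lborel" using p by simp
  have [measurable]: "(\<lambda>x. u j x \<beta>) \<in> borel_measurable lborel" if "j \<le> Suc n" for j
    using measurable_compose[OF measurable_Pair2' meas[OF that], of \<beta>] by simp
  have int: "integrable lborel (\<lambda>x. p x * ((\<beta> - \<pi> x) ^ j / fact j * u j x \<beta>))" if j: "j \<le> n" for j
  proof (rule integrable_mult_bounded_on_support[OF p])
    show "(\<lambda>x. (\<beta> - \<pi> x) ^ j / fact j * u j x \<beta>) \<in> borel_measurable lborel"
      using j by simp
    show "\<bar>(\<beta> - \<pi> x) ^ j / fact j * u j x \<beta>\<bar> \<le> (\<beta> - \<alpha>) ^ j / fact j * B" if "p x \<noteq> 0" for x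
      unfolding abs_mult
    proof (rule mult_mono)
      show "\<bar>(\<beta> - \<pi> x) ^ j / fact j\<bar> \<le> (\<beta> - \<alpha>) ^ j / fact j"
        using supp[OF that] by (auto intro!: divide_right_mono power_mono)
      show "\<bar>u j x \<beta>\<bar> \<le> B" using supp[OF that] j by (intro bnd that) auto
      show "0 \<le> (\<beta> - \<alpha>) ^ j / fact j" using supp[OF that] by auto
    qed simp
  qed
  define k where "k x t = indicator {\<alpha>..\<beta>} t * (trunc_pow n (\<pi> x) t * u (Suc n) x t)" for x t
  have [measurable]: "(\<lambda>(x, t). u (Suc n) x t) \<in> borel_measurable (lborel \<Otimes>\<^sub>M lborel)"
    by (rule meas) simp
  have k_meas[measurable]: "(\<lambda>(x, t). k x t) \<in> borel_measurable (lborel \<Otimes>\<^sub>M lborel)"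
    unfolding k_def by measurable
  define C where "C = (\<beta> - \<alpha>) ^ n / fact n * B"
  have k_bnd: "\<bar>k x t\<bar> \<le> C * indicator {\<alpha>..\<beta>} t" if "p x \<noteq> 0" for x t
  proof (cases "t \<in> {\<alpha>..\<beta>}")
    case True
    have "\<bar>trunc_pow n (\<pi> x) t\<bar> * \<bar>u (Suc n) x t\<bar> \<le> C"
      unfolding C_def
    proof (rule mult_mono)
      show "\<bar>trunc_pow n (\<pi> x) t\<bar> \<le> (\<beta> - \<alpha>) ^ n / fact n"
        using supp[OF that] True by (rule abs_trunc_pow_le)
      show "\<bar>u (Suc n) x t\<bar> \<le> B" using that True by (intro bnd) auto
      show "0 \<le> (\<beta> - \<alpha>) ^ n / fact n" using True by auto
    qed simp
    then show ?thesis using True by (simp add: k_def abs_mult)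
  qed (simp add: k_def)
  \<comment> \<open>The majorant is a product of an integrable function of x and one of t, which
    gives the absolute integrability that Fubini needs.\<close>
  have pk: "integrable (lborel \<Otimes>\<^sub>M lborel) (\<lambda>(x, t). p x * k x t)"
  proof (rule Bochner_Integration.integrable_bound)
    have int_ind: "integrable lborel (indicator {\<alpha>..\<beta>} :: real \<Rightarrow> real)"
      by (simp add: integrable_indicator_iff emeasure_lborel_Icc_eq)
    have meas_ind: "(\<lambda>(x, t). \<bar>p x\<bar> * (C * indicator {\<alpha>..\<beta>} t)) \<in> borel_measurable (lborel \<Otimes>\<^sub>M (lborel::real measure))"
      by measurable
    show "integrable (lborel \<Otimes>\<^sub>M lborel) (\<lambda>(x, t). \<bar>p x\<bar> * (C * indicator {\<alpha>..\<beta>} t))"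
      by (rule lborel_pair.Fubini_integrable[OF meas_ind])
        (use p int_ind in \<open>auto simp: abs_mult\<close>)
    show "(\<lambda>(x, t). p x * k x t) \<in> borel_measurable (lborel \<Otimes>\<^sub>M lborel)"
      by measurable
    have "\<bar>p x * k x t\<bar> \<le> \<bar>\<bar>p x\<bar> * (C * indicator {\<alpha>..\<beta>} t)\<bar>" for x t
    proof (cases "p x = 0")
      case False
      have "\<bar>k x t\<bar> \<le> \<bar>C * indicator {\<alpha>..\<beta>} t\<bar>" using k_bnd[OF False, of t] by linarith
      then show ?thesis by (simp add: abs_mult mult_left_mono)
    qed simp
    then show "AE z in lborel \<Otimes>\<^sub>M lborel. norm (case z of (x, t) \<Rightarrow> p x * k x t)
        \<le> norm (case z of (x, t) \<Rightarrow> \<bar>p x\<bar> * (C * indicator {\<alpha>..\<beta>} t))"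
      by (simp add: case_prod_beta)
  qed
  have int_k: "integrable lborel (\<lambda>x. p x * (LINT t|lborel. k x t))"
    using lborel_pair.integrable_fst'[OF pk] by simp
  have "(LINT x|lborel. p x * u 0 x (\<pi> x)) =
    (LINT x|lborel. (\<Sum>j\<le>n. (-1) ^ j * (p x * ((\<beta> - \<pi> x) ^ j / fact j * u j x \<beta>))) +
      (-1) ^ Suc n * (p x * (LINT t|lborel. k x t)))"
  proof (rule Bochner_Integration.integral_cong[OF refl])
    fix x
    show "p x * u 0 x (\<pi> x) =
      (\<Sum>j\<le>n. (-1) ^ j * (p x * ((\<beta> - \<pi> x) ^ j / fact j * u j x \<beta>))) +
      (-1) ^ Suc n * (p x * (LINT t|lborel. k x t))"
    proof (cases "p x = 0")
      case False
      have "u 0 x (\<pi> x) = (\<Sum>j\<le>n. (-1) ^ j * ((\<beta> - \<pi> x) ^ j / fact j * u j x \<beta>)) +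
        (-1) ^ Suc n * (LINT t|lborel. k x t)"
        unfolding k_def using taylor_trunc_pow[of n \<alpha> \<beta> "\<lambda>j. u j x", OF deriv cont supp] False
        by blast
      then show ?thesis by (simp only: distrib_left sum_distrib_left mult.left_commute)
    qed simp
  qed
  also have "\<dots> = (\<Sum>j\<le>n. (-1) ^ j * (LINT x|lborel. p x * ((\<beta> - \<pi> x) ^ j / fact j * u j x \<beta>))) +
      (-1) ^ Suc n * (LINT x|lborel. p x * (LINT t|lborel. k x t))"
  proof (subst Bochner_Integration.integral_add)
    show int': "integrable lborel (\<lambda>x. \<Sum>j\<le>n. (-1) ^ j * (p x * ((\<beta> - \<pi> x) ^ j / fact j * u j x \<beta>)))"
      using int by (intro Bochner_Integration.integrable_sum integrable_mult_right) auto
    show "integrable lborel (\<lambda>x. (-1) ^ Suc n * (p x * (LINT t|lborel. k x t)))"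
      using int_k by (rule integrable_mult_right)
    show "(LINT x|lborel. (\<Sum>j\<le>n. (-1) ^ j * (p x * ((\<beta> - \<pi> x) ^ j / fact j * u j x \<beta>)))) +
        (LINT x|lborel. (-1) ^ Suc n * (p x * (LINT t|lborel. k x t))) =
      (\<Sum>j\<le>n. (-1) ^ j * (LINT x|lborel. p x * ((\<beta> - \<pi> x) ^ j / fact j * u j x \<beta>))) +
        (-1) ^ Suc n * (LINT x|lborel. p x * (LINT t|lborel. k x t))"
      using int by (subst Bochner_Integration.integral_sum)
        (simp_all only: integral_mult_right_zero integrable_mult_right atMost_iff)
  qed
  also have "(LINT x|lborel. p x * (LINT t|lborel. k x t)) = (LINT x|lborel. LINT t|lborel. p x * k x t)"
    by simp
  also have "\<dots> = (LINT t|lborel. LINT x|lborel. p x * k x t)"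
    using lborel_pair.Fubini_integral[OF pk] by simp
  also have "\<dots> = (LINT t|lborel. indicator {\<alpha>..\<beta>} t *
      (LINT x|lborel. p x * (trunc_pow n (\<pi> x) t * u (Suc n) x t)))"
    unfolding k_def integral_mult_right_zero[symmetric]
    by (simp add: mult.left_commute)
  finally show ?thesis .
qed

section \<open>Families of partial derivatives on the rectangle\<close>

text \<open>The derivatives are carried as an explicit family \<open>F\<close>, so that
  \<open>f\<close>, the monomial \<open>G0\<close> with its closed formulas, and the clamped
  extension are treated alike. Derivatives in the second variable occur only at i = 0, since
  \<open>partial_deriv\<close> differentiates in that variable first.\<close>

definition derivative_grid ::
    "real \<Rightarrow> real \<Rightarrow> real \<Rightarrow> real \<Rightarrow> nat \<Rightarrow> nat \<Rightarrow> (nat \<Rightarrow> nat \<Rightarrow> real \<Rightarrow> real \<Rightarrow> real) \<Rightarrow> bool" where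
  "derivative_grid a b c d m n F \<longleftrightarrow>
     (\<forall>j<n. \<forall>y\<in>{a..b}. \<forall>z\<in>{c..d}.
        (F 0 j y has_vector_derivative F 0 (Suc j) y z) (at z within {c..d})) \<and>
     (\<forall>i<m. \<forall>j\<le>n. \<forall>y\<in>{a..b}. \<forall>z\<in>{c..d}.
        ((\<lambda>u. F i j u z) has_vector_derivative F (Suc i) j y z) (at y within {a..b})) \<and>
     (\<forall>i\<le>m. \<forall>j\<le>n. continuous_on ({a..b} \<times> {c..d}) (\<lambda>x. F i j (fst x) (snd x)))"

lemma C_class_derivative_grid:
  assumes "C_class m n {a..b} {c..d} f"
  shows "derivative_grid a b c d m n (partial_deriv {a..b} {c..d} f)"
  using assms
  unfolding C_class_def derivative_grid_def vector_derivative_works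
  by (auto simp: partial_deriv_def deriv_fst_def deriv_snd_def case_prod_beta)

text \<open>At i = M+1 and j = N+1 both exponents are 0, so the top entry is the constant
  (-1)^(M+N); this makes \<open>G0\<close> the test function that measures the total mass of the
  kernel.\<close>

lemma derivative_grid_G0:
  "derivative_grid a b c d (M + 1) (N + 1) (\<lambda>i j y z.
     (-1) ^ (M + N) * (y ^ (M + 1 - i) / fact (M + 1 - i)) * (z ^ (N + 1 - j) / fact (N + 1 - j)))"
proof -
  have "((\<lambda>x. x ^ Suc e / fact (Suc e)) has_vector_derivative x ^ e / fact e) (at x within S)"
    for x :: real and e S
    by (auto simp: has_real_derivative_iff_has_vector_derivative[symmetric] divide_simps
        intro!: derivative_eq_intros) (cases e, auto simp: algebra_simps)
  then have pow: "((\<lambda>x. x ^ (Suc n - k) / fact (Suc n - k)) has_vector_derivative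
      x ^ (Suc n - Suc k) / fact (Suc n - Suc k)) (at x within S)" if "k < Suc n" for x :: real and n k S
    using that by (metis Suc_diff_le diff_Suc_Suc less_Suc_eq_le)
  have mono: "continuous_on A (\<lambda>x. w * (fst x ^ k / fact k) * (snd x ^ l / fact l))"
    for A :: "(real \<times> real) set" and k l and w :: real
    by (intro continuous_intros) auto
  show ?thesis
    unfolding derivative_grid_def
  proof (intro conjI allI impI ballI)
    fix j y z assume "j < N + 1"
    then show "((\<lambda>z. (-1) ^ (M + N) * (y ^ (M + 1 - 0) / fact (M + 1 - 0)) *
        (z ^ (N + 1 - j) / fact (N + 1 - j))) has_vector_derivative
      (-1) ^ (M + N) * (y ^ (M + 1 - 0) / fact (M + 1 - 0)) *
        (z ^ (N + 1 - Suc j) / fact (N + 1 - Suc j))) (at z within {c..d})"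
      using pow[of j N] by (intro has_vector_derivative_mult_right) simp
  next
    fix i j y z assume "i < M + 1"
    then show "((\<lambda>u. (-1) ^ (M + N) * (u ^ (M + 1 - i) / fact (M + 1 - i)) *
        (z ^ (N + 1 - j) / fact (N + 1 - j))) has_vector_derivative
      (-1) ^ (M + N) * (y ^ (M + 1 - Suc i) / fact (M + 1 - Suc i)) *
        (z ^ (N + 1 - j) / fact (N + 1 - j))) (at y within {a..b})"
      using pow[of i M]
      by (intro has_vector_derivative_mult_left has_vector_derivative_mult_right) simp
  qed (rule mono)
qed

text \<open>Clamping the arguments to the rectangle gives globally continuous functions, so that
  measurability needs no restriction to the rectangle.\<close>

lemma derivative_grid_extend:
  assumes F: "derivative_grid a b c d m n F" and "a \<le> b" "c \<le> d"
  obtains G B where "derivative_grid a b c d m n G"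
    and "\<And>i j y z. y \<in> {a..b} \<Longrightarrow> z \<in> {c..d} \<Longrightarrow> G i j y z = F i j y z"
    and "\<And>i j. i \<le> m \<Longrightarrow> j \<le> n \<Longrightarrow> continuous_on UNIV (\<lambda>x. G i j (fst x) (snd x))"
    and "\<And>i j y z. i \<le> m \<Longrightarrow> j \<le> n \<Longrightarrow> \<bar>G i j y z\<bar> \<le> B"
proof -
  define ry rz where "ry y = max a (min b y)" and "rz z = max c (min d z)" for y z
  have r: "ry y \<in> {a..b}" "rz z \<in> {c..d}" for y z
    using assms(2,3) by (auto simp: ry_def rz_def)
  have r_eq: "y \<in> {a..b} \<Longrightarrow> ry y = y" "z \<in> {c..d} \<Longrightarrow> rz z = z" for y z
    by (auto simp: ry_def rz_def)
  define G where "G i j y z = F i j (ry y) (rz z)" for i j y z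
  have G: "G i j y z = F i j y z" if "y \<in> {a..b}" "z \<in> {c..d}" for i j y z
    using that by (simp add: G_def r_eq)
  have cont: "continuous_on ({a..b} \<times> {c..d}) (\<lambda>x. F i j (fst x) (snd x))" if "i \<le> m" "j \<le> n" for i j
    using F that unfolding derivative_grid_def by blast
  have G_cont: "continuous_on UNIV (\<lambda>x. G i j (fst x) (snd x))" if "i \<le> m" "j \<le> n" for i j
  proof -
    have "continuous_on UNIV (\<lambda>x. (ry (fst x), rz (snd x)))"
      unfolding ry_def rz_def by (intro continuous_intros)
    from continuous_on_compose2[OF cont[OF that] this] show ?thesis
      using r unfolding G_def by fastforce
  qed
  \<comment> \<open>All finitely many entries are collected in one bounded set, so that a single
    \<open>B\<close> serves every pair (i,j).\<close>
  define T where "T = (\<Union>i\<in>{..m}. \<Union>j\<in>{..n}. (\<lambda>x. F i j (fst x) (snd x)) ` ({a..b} \<times> {c..d}))"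
  have "bounded T"
    unfolding T_def
    by (intro bounded_UN finite_atMost ballI compact_imp_bounded compact_continuous_image cont
        compact_Times compact_Icc) auto
  then obtain B where B: "\<And>v. v \<in> T \<Longrightarrow> \<bar>v\<bar> \<le> B"
    unfolding bounded_iff by auto
  have G_bnd: "\<bar>G i j y z\<bar> \<le> B" if "i \<le> m" "j \<le> n" for i j y z
  proof (rule B)
    have "F i j (ry y) (rz z) \<in> (\<lambda>x. F i j (fst x) (snd x)) ` ({a..b} \<times> {c..d})"
      using r by (intro image_eqI[where x = "(ry y, rz z)"]) auto
    then show "G i j y z \<in> T" unfolding G_def T_def using that by blast
  qed
  \<comment> \<open>Derivatives are taken within the intervals, where clamping is the identity; its
    kinks at the end points are therefore invisible.\<close>
  have "derivative_grid a b c d m n G"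
    unfolding derivative_grid_def
  proof (intro conjI allI impI ballI)
    fix j y z assume *: "j < n" "y \<in> {a..b}" "z \<in> {c..d}"
    then have "(F 0 j y has_vector_derivative G 0 (Suc j) y z) (at z within {c..d})"
      using F unfolding derivative_grid_def by (simp add: G)
    then show "(G 0 j y has_vector_derivative G 0 (Suc j) y z) (at z within {c..d})"
      using * by (auto intro: has_vector_derivative_transform[rotated 2] simp: G)
  next
    fix i j y z assume *: "i < m" "j \<le> n" "y \<in> {a..b}" "z \<in> {c..d}"
    then have "((\<lambda>u. F i j u z) has_vector_derivative G (Suc i) j y z) (at y within {a..b})"
      using F unfolding derivative_grid_def by (simp add: G)
    then show "((\<lambda>u. G i j u z) has_vector_derivative G (Suc i) j y z) (at y within {a..b})"
      using * by (auto intro: has_vector_derivative_transform[rotated 2] simp: G)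
  next
    fix i j assume "i \<le> m" "j \<le> n"
    then show "continuous_on ({a..b} \<times> {c..d}) (\<lambda>x. G i j (fst x) (snd x))"
      using G_cont continuous_on_subset by blast
  qed
  then show ?thesis using G G_cont G_bnd by (rule that)
qed

section \<open>The two-variable expansion\<close>

text \<open>Here \<open>p x * w x\<close> serves as the density, with \<open>w\<close> the factor
  left by the expansion in the other variable. As \<open>u\<close> depends on the first coordinate
  alone, its derivatives at b and at s leave the integral over x, and pure moments of
  \<open>p\<close> remain.\<close>

lemma integral_taylor_fst:
  fixes p w :: "real \<times> real \<Rightarrow> real" and u :: "nat \<Rightarrow> real \<Rightarrow> real"
  assumes p: "integrable lborel p" and w[measurable]: "w \<in> borel_measurable borel"
    and supp: "\<And>x. p x \<noteq> 0 \<Longrightarrow> fst x \<in> {a..b}"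
    and w_bnd: "\<And>x. p x \<noteq> 0 \<Longrightarrow> \<bar>w x\<bar> \<le> W"
    and deriv: "\<And>i s. i \<le> m \<Longrightarrow> s \<in> {a..b} \<Longrightarrow>
      (u i has_vector_derivative u (Suc i) s) (at s within {a..b})"
    and cont: "\<And>i. i \<le> Suc m \<Longrightarrow> continuous_on UNIV (u i)"
    and bnd: "\<And>i s. i \<le> Suc m \<Longrightarrow> \<bar>u i s\<bar> \<le> B"
  shows "(LINT x|lborel. p x * (w x * u 0 (fst x))) =
    (\<Sum>i\<le>m. (-1) ^ i * (u i b * (LINT x|lborel. p x * ((b - fst x) ^ i / fact i * w x)))) +
    (-1) ^ Suc m * (LINT s|lborel. indicator {a..b} s *
      ((LINT x|lborel. p x * (trunc_pow m (fst x) s * w x)) * u (Suc m) s))"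
proof -
  have pw: "integrable lborel (\<lambda>x. p x * w x)"
    using w_bnd by (intro integrable_mult_bounded_on_support[OF p]) auto
  have meas: "(\<lambda>(x, s). u i s) \<in> borel_measurable (lborel \<Otimes>\<^sub>M lborel)" if "i \<le> Suc m" for i
  proof -
    have [measurable]: "u i \<in> borel_measurable borel"
      using cont[OF that] by (rule borel_measurable_continuous_onI)
    show ?thesis by measurable
  qed
  have "(LINT x|lborel. (p x * w x) * u 0 (fst x)) =
    (\<Sum>i\<le>m. (-1) ^ i * (LINT x|lborel. (p x * w x) * ((b - fst x) ^ i / fact i * u i b))) +
    (-1) ^ Suc m * (LINT s|lborel. indicator {a..b} s *
      (LINT x|lborel. (p x * w x) * (trunc_pow m (fst x) s * u (Suc m) s)))"
  proof (rule integral_taylor_trunc_pow[OF pw, where u = "\<lambda>i x. u i"])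
    show "continuous_on {a..b} (u (Suc m))" using cont[of "Suc m"] continuous_on_subset by blast
  qed (use supp deriv meas bnd in auto)
  moreover have "(LINT x|lborel. (p x * w x) * ((b - fst x) ^ i / fact i * u i b)) =
      u i b * (LINT x|lborel. p x * ((b - fst x) ^ i / fact i * w x))" for i
    unfolding integral_mult_right_zero[symmetric] by (simp only: mult_ac)
  moreover have "(LINT x|lborel. (p x * w x) * (trunc_pow m (fst x) s * u (Suc m) s)) =
      (LINT x|lborel. p x * (trunc_pow m (fst x) s * w x)) * u (Suc m) s" for s
    unfolding integral_mult_left_zero[symmetric] by (simp only: mult_ac)
  ultimately show ?thesis by (simp only: mult.assoc)
qed

text \<open>After the expansion in the second variable, every term has that argument frozen, at d or
  at t. Each is thus a function of the first coordinate times a weight, ready for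
  \<open>integral_taylor_fst\<close>.\<close>

lemma integral_derivative_grid:
  fixes p :: "real \<times> real \<Rightarrow> real"
  assumes p: "integrable lborel p" and supp: "\<And>x. x \<notin> {a..b} \<times> {c..d} \<Longrightarrow> p x = 0"
    and "a \<le> b" "c \<le> d"
    and F: "derivative_grid a b c d (Suc M) (Suc N) F"
    and poly_poly: "\<And>i j. i \<le> M \<Longrightarrow> j \<le> N \<Longrightarrow>
      (LINT x|lborel. p x * ((b - fst x) ^ i / fact i * ((d - snd x) ^ j / fact j))) = 0"
    and trunc_poly: "\<And>j s. j \<le> N \<Longrightarrow> s \<in> {a..b} \<Longrightarrow>
      (LINT x|lborel. p x * (trunc_pow M (fst x) s * ((d - snd x) ^ j / fact j))) = 0"
    and poly_trunc: "\<And>i t. i \<le> M \<Longrightarrow> t \<in> {c..d} \<Longrightarrow>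
      (LINT x|lborel. p x * ((b - fst x) ^ i / fact i * trunc_pow N (snd x) t)) = 0"
  shows "(LINT x|lborel. p x * F 0 0 (fst x) (snd x)) = (-1) ^ (M + N) *
    (LINT t|lborel. indicator {c..d} t * (LINT s|lborel. indicator {a..b} s *
      ((LINT x|lborel. p x * (trunc_pow M (fst x) s * trunc_pow N (snd x) t)) * F (Suc M) (Suc N) s t)))"
proof -
  obtain G B where G: "derivative_grid a b c d (Suc M) (Suc N) G"
    and GF: "\<And>i j y z. y \<in> {a..b} \<Longrightarrow> z \<in> {c..d} \<Longrightarrow> G i j y z = F i j y z"
    and cont: "\<And>i j. i \<le> Suc M \<Longrightarrow> j \<le> Suc N \<Longrightarrow> continuous_on UNIV (\<lambda>x. G i j (fst x) (snd x))"
    and bnd: "\<And>i j y z. i \<le> Suc M \<Longrightarrow> j \<le> Suc N \<Longrightarrow> \<bar>G i j y z\<bar> \<le> B"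
    using derivative_grid_extend[OF F \<open>a \<le> b\<close> \<open>c \<le> d\<close>] by blast
  have suppD: "fst x \<in> {a..b}" "snd x \<in> {c..d}" if "p x \<noteq> 0" for x
    using supp[of x] that by (auto simp: mem_Times_iff)
  have cont_fst: "continuous_on UNIV (\<lambda>s. G i j s t)"
    and cont_snd: "continuous_on UNIV (\<lambda>t. G i j s t)" if "i \<le> Suc M" "j \<le> Suc N" for i j s t
    using continuous_on_compose2[OF cont[OF that] continuous_on_Pair[OF continuous_on_id continuous_on_const]]
      continuous_on_compose2[OF cont[OF that] continuous_on_Pair[OF continuous_on_const continuous_on_id]]
    by auto
  have deriv_fst: "((\<lambda>s. G i j s t) has_vector_derivative G (Suc i) j s t) (at s within {a..b})"
    if "i \<le> M" "j \<le> Suc N" "s \<in> {a..b}" "t \<in> {c..d}" for i j s t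
    using G that unfolding derivative_grid_def by auto
  have deriv_snd: "(G 0 j s has_vector_derivative G 0 (Suc j) s t) (at t within {c..d})"
    if "j \<le> N" "s \<in> {a..b}" "t \<in> {c..d}" for j s t
    using G that unfolding derivative_grid_def by auto
  define K where "K s t = (LINT x|lborel. p x * (trunc_pow M (fst x) s * trunc_pow N (snd x) t))" for s t
  have expand_fst: "(LINT x|lborel. p x * (w x * G 0 j (fst x) t)) =
    (\<Sum>i\<le>M. (-1) ^ i * (G i j b t * (LINT x|lborel. p x * ((b - fst x) ^ i / fact i * w x)))) +
    (-1) ^ Suc M * (LINT s|lborel. indicator {a..b} s *
      ((LINT x|lborel. p x * (trunc_pow M (fst x) s * w x)) * G (Suc M) j s t))"
    if "j \<le> Suc N" "t \<in> {c..d}" "w \<in> borel_measurable borel" "\<And>x. p x \<noteq> 0 \<Longrightarrow> \<bar>w x\<bar> \<le> W" for w j t W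
    using that suppD
    by (intro integral_taylor_fst[OF p, where u = "\<lambda>i s. G i j s t" and B = B and W = W] deriv_fst cont_fst bnd) auto
  \<comment> \<open>Polynomial part in z: \<open>poly_poly\<close> kills its polynomial part in y,
    and \<open>trunc_poly\<close> kills the remainder in y for every s.\<close>
  have poly: "(LINT x|lborel. p x * ((d - snd x) ^ j / fact j * G 0 j (fst x) d)) = 0" if j: "j \<le> N" for j
  proof -
    have "\<bar>(d - snd x) ^ j / fact j\<bar> \<le> (d - c) ^ j / fact j" if "p x \<noteq> 0" for x
      using suppD[OF that] by (auto intro!: divide_right_mono power_mono)
    then have "(LINT x|lborel. p x * ((d - snd x) ^ j / fact j * G 0 j (fst x) d)) =
      (\<Sum>i\<le>M. (-1) ^ i * (G i j b d *
        (LINT x|lborel. p x * ((b - fst x) ^ i / fact i * ((d - snd x) ^ j / fact j))))) +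
      (-1) ^ Suc M * (LINT s|lborel. indicator {a..b} s *
        ((LINT x|lborel. p x * (trunc_pow M (fst x) s * ((d - snd x) ^ j / fact j))) * G (Suc M) j s d))"
      using j \<open>c \<le> d\<close> by (intro expand_fst) auto
    also have "\<dots> = 0"
    proof -
      have z: "indicator {a..b} s *
        ((LINT x|lborel. p x * (trunc_pow M (fst x) s * ((d - snd x) ^ j / fact j))) * G (Suc M) j s d) = 0" for s
        using trunc_poly[OF j, of s] by (cases "s \<in> {a..b}") auto
      show ?thesis unfolding z using poly_poly[OF _ j] by simp
    qed
    finally show ?thesis .
  qed
  \<comment> \<open>Remainder in z: \<open>poly_trunc\<close> removes the polynomial part in y and
    only \<open>K\<close> is left. With the indicator included the identity holds for every t, so it
    can be rewritten under the integral.\<close>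
  have trunc: "indicator {c..d} t * (LINT x|lborel. p x * (trunc_pow N (snd x) t * G 0 (Suc N) (fst x) t)) =
      (-1) ^ Suc M * (indicator {c..d} t *
        (LINT s|lborel. indicator {a..b} s * (K s t * F (Suc M) (Suc N) s t)))" for t
  proof (cases "t \<in> {c..d}")
    case t: True
    have "(LINT x|lborel. p x * (trunc_pow N (snd x) t * G 0 (Suc N) (fst x) t)) =
      (\<Sum>i\<le>M. (-1) ^ i * (G i (Suc N) b t *
        (LINT x|lborel. p x * ((b - fst x) ^ i / fact i * trunc_pow N (snd x) t)))) +
      (-1) ^ Suc M * (LINT s|lborel. indicator {a..b} s *
        ((LINT x|lborel. p x * (trunc_pow M (fst x) s * trunc_pow N (snd x) t)) * G (Suc M) (Suc N) s t))"
      using t suppD by (intro expand_fst[OF _ t, where W = "(d - c) ^ N / fact N"] abs_trunc_pow_le) auto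
    also have "\<dots> = (-1) ^ Suc M *
        (LINT s|lborel. indicator {a..b} s * (K s t * G (Suc M) (Suc N) s t))"
      using poly_trunc[OF _ t] by (simp add: K_def)
    also have "(LINT s|lborel. indicator {a..b} s * (K s t * G (Suc M) (Suc N) s t)) =
        (LINT s|lborel. indicator {a..b} s * (K s t * F (Suc M) (Suc N) s t))"
      using t by (intro Bochner_Integration.integral_cong) (auto simp: GF indicator_def)
    finally show ?thesis using t by simp
  qed simp
  have "(LINT x|lborel. p x * F 0 0 (fst x) (snd x)) = (LINT x|lborel. p x * G 0 0 (fst x) (snd x))"
  proof (intro Bochner_Integration.integral_cong refl)
    show "p x * F 0 0 (fst x) (snd x) = p x * G 0 0 (fst x) (snd x)" for x
      using suppD[of x] GF[of "fst x" "snd x"] by (cases "p x = 0") auto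
  qed
  also have "\<dots> =
    (\<Sum>j\<le>N. (-1) ^ j * (LINT x|lborel. p x * ((d - snd x) ^ j / fact j * G 0 j (fst x) d))) +
    (-1) ^ Suc N * (LINT t|lborel. indicator {c..d} t *
      (LINT x|lborel. p x * (trunc_pow N (snd x) t * G 0 (Suc N) (fst x) t)))"
  proof (rule integral_taylor_trunc_pow[OF p, where u = "\<lambda>j x. G 0 j (fst x)" and B = B])
    \<comment> \<open>Joint measurability on the whole space comes from the global continuity of the
      clamped family.\<close>
    show "(\<lambda>(x :: real \<times> real, t). G 0 j (fst x) t) \<in> borel_measurable (lborel \<Otimes>\<^sub>M lborel)" if j: "j \<le> Suc N"
      for j
    proof -
      have "continuous_on UNIV (\<lambda>x :: (real \<times> real) \<times> real. G 0 j (fst (fst x)) (snd x))"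
        using j by (intro continuous_on_compose2[OF cont[of 0 j], where f = "\<lambda>x. (fst (fst x), snd x)", simplified]
            continuous_intros) auto
      from borel_measurable_continuous_onI[OF this] show ?thesis
        by (simp add: lborel_prod case_prod_beta')
    qed
    show "continuous_on {c..d} (G 0 (Suc N) (fst x))" for x
      using cont_snd[of 0 "Suc N" "fst x"] continuous_on_subset by blast
  qed (use suppD deriv_snd bnd in auto)
  also have "\<dots> = (-1) ^ (M + N) * (LINT t|lborel. indicator {c..d} t *
        (LINT s|lborel. indicator {a..b} s * (K s t * F (Suc M) (Suc N) s t)))"
    unfolding trunc integral_mult_right_zero using poly by (simp add: power_add)
  finally show ?thesis unfolding K_def .
qed

section \<open>Mean value theorem for a nonnegative weight on a rectangle\<close>

text \<open>The weighted integral lies between the minimum and the maximum of \<open>D\<close> times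
  the mass of \<open>K\<close>; since the rectangle is connected, \<open>D\<close> attains the
  quotient. Of \<open>K\<close> only sign, measurability and boundedness enter.\<close>

lemma weighted_mean_value_rectangle:
  fixes K D :: "real \<Rightarrow> real \<Rightarrow> real"
  assumes "a \<le> b" "c \<le> d"
    and D: "continuous_on ({a..b} \<times> {c..d}) (\<lambda>x. D (fst x) (snd x))"
    and K[measurable]: "(\<lambda>x. K (fst x) (snd x)) \<in> borel_measurable borel"
    and K_nonneg: "\<And>s t. s \<in> {a..b} \<Longrightarrow> t \<in> {c..d} \<Longrightarrow> 0 \<le> K s t"
    and K_bnd: "\<And>s t. s \<in> {a..b} \<Longrightarrow> t \<in> {c..d} \<Longrightarrow> K s t \<le> C"
  shows "\<exists>\<eta>\<in>{a..b}. \<exists>\<zeta>\<in>{c..d}.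
    (LINT t|lborel. indicator {c..d} t * (LINT s|lborel. indicator {a..b} s * (K s t * D s t))) =
    D \<eta> \<zeta> * (LINT t|lborel. indicator {c..d} t * (LINT s|lborel. indicator {a..b} s * K s t))"
proof -
  define R where "R = {a..b} \<times> {c..d}"
  define D' where "D' x = D (fst x) (snd x)" for x
  define k where "k x = indicator R x * K (fst x) (snd x)" for x
  have R: "compact R" "connected R" "R \<noteq> {}"
    unfolding R_def using assms(1,2)
    by (auto intro!: compact_Times connected_Times)
  have [measurable]: "R \<in> sets borel" using R(1) by (rule borel_compact)
  have D': "continuous_on R D'" using D unfolding R_def D'_def .
  obtain l where l: "l \<in> R" "\<And>x. x \<in> R \<Longrightarrow> D' l \<le> D' x"
    using continuous_attains_inf[OF R(1,3) D'] by auto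
  obtain h where h: "h \<in> R" "\<And>x. x \<in> R \<Longrightarrow> D' x \<le> D' h"
    using continuous_attains_sup[OF R(1,3) D'] by auto
  have k_nonneg: "0 \<le> k x" for x
    using K_nonneg by (auto simp: k_def R_def indicator_def)
  have [measurable]: "k \<in> borel_measurable borel" unfolding k_def by measurable
  have "integrable lborel (\<lambda>x. indicator R x * K (fst x) (snd x))"
  proof (rule integrable_mult_bounded_on_support)
    show "integrable lborel (indicator R :: real \<times> real \<Rightarrow> real)"
      using R(1) emeasure_compact_finite[OF R(1)] by (simp add: integrable_indicator_iff)
    show "\<bar>K (fst x) (snd x)\<bar> \<le> C" if "indicator R x \<noteq> (0::real)" for x
      using that K_nonneg K_bnd by (auto simp: R_def indicator_def split: if_splits)
  qed simp
  then have int_k: "integrable lborel k" unfolding k_def .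
  have [measurable]: "(\<lambda>x. indicator R x * D' x) \<in> borel_measurable borel"
    using borel_measurable_continuous_on_indicator[OF _ D'] by simp
  have "integrable lborel (\<lambda>x. k x * (indicator R x * D' x))"
  proof (rule integrable_mult_bounded_on_support[OF int_k])
    show "\<bar>indicator R x * D' x\<bar> \<le> max \<bar>D' l\<bar> \<bar>D' h\<bar>" for x
      using l(2)[of x] h(2)[of x] by (auto simp: indicator_def)
  qed simp
  also have "(\<lambda>x. k x * (indicator R x * D' x)) = (\<lambda>x. k x * D' x)"
    by (auto simp: k_def indicator_def)
  finally have int_kD: "integrable lborel (\<lambda>x. k x * D' x)" .
  have iter: "(LINT t|lborel. indicator {c..d} t * (LINT s|lborel. indicator {a..b} s * g s t)) =
      (LINT x|lborel. indicator R x * g (fst x) (snd x))"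
    if "integrable lborel (\<lambda>x. indicator R x * g (fst x) (snd x))" for g :: "real \<Rightarrow> real \<Rightarrow> real"
  proof -
    have "integrable (lborel \<Otimes>\<^sub>M lborel) (\<lambda>(s, t). indicator R (s, t) * g s t)"
      using that by (simp add: lborel_prod case_prod_beta')
    moreover have "(LINT s|lborel. indicator R (s, t) * g s t) =
        indicator {c..d} t * (LINT s|lborel. indicator {a..b} s * g s t)" for t
      unfolding integral_mult_right_zero[symmetric] by (simp add: R_def indicator_times mult_ac)
    ultimately show ?thesis
      using lborel_pair.integral_snd[of "\<lambda>s t. indicator R (s, t) * g s t"]
      by (simp add: lborel_prod case_prod_beta')
  qed
  have I: "(LINT t|lborel. indicator {c..d} t * (LINT s|lborel. indicator {a..b} s * K s t)) =
      (LINT x|lborel. k x)"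
    using iter[of K] int_k unfolding k_def by simp
  have J: "(LINT t|lborel. indicator {c..d} t * (LINT s|lborel. indicator {a..b} s * (K s t * D s t))) =
      (LINT x|lborel. k x * D' x)"
    using iter[of "\<lambda>s t. K s t * D s t"] int_kD unfolding k_def D'_def by (simp add: mult.assoc)
  have k_bnds: "D' l * k x \<le> k x * D' x" "k x * D' x \<le> D' h * k x" for x
    using mult_left_mono[OF l(2) k_nonneg, of x x] mult_left_mono[OF h(2) k_nonneg, of x x]
    by (cases "x \<in> R"; simp add: k_def mult.commute)+
  have lower: "D' l * (LINT x|lborel. k x) \<le> (LINT x|lborel. k x * D' x)"
    unfolding integral_mult_right_zero[symmetric]
    using int_k int_kD k_bnds by (intro integral_mono) auto
  have upper: "(LINT x|lborel. k x * D' x) \<le> D' h * (LINT x|lborel. k x)"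
    unfolding integral_mult_right_zero[symmetric]
    using int_k int_kD k_bnds by (intro integral_mono) auto
  have "\<exists>x\<in>R. (LINT x|lborel. k x * D' x) = D' x * (LINT x|lborel. k x)"
  \<comment> \<open>If the weight has mass 0, both bounds collapse to 0 and any point works; the
    minimizer \<open>l\<close> is taken. Otherwise the weighted average \<open>r\<close> is
    defined.\<close>
  proof (cases "(LINT x|lborel. k x) = 0")
    case True
    then show ?thesis using lower upper l(1) by (intro bexI[of _ l]) auto
  next
    case False
    define r where "r = (LINT x|lborel. k x * D' x) / (LINT x|lborel. k x)"
    have "(LINT x|lborel. k x) \<ge> 0" using k_nonneg by simp
    with False have pos: "(LINT x|lborel. k x) > 0" by simp
    have "r \<in> {D' l..D' h}"
      using lower upper pos by (simp add: r_def le_divide_eq divide_le_eq)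
    moreover have "{D' l..D' h} \<subseteq> D' ` R"
      using connected_continuous_image[OF D' R(2)] l(1) h(1)
      by (intro connected_contains_Icc) auto
    ultimately obtain x where "x \<in> R" "D' x = r" by auto
    then show ?thesis using pos by (intro bexI[of _ x]) (auto simp: r_def)
  qed
  then show ?thesis unfolding I J by (auto simp: R_def D'_def)
qed

section \<open>The hypotheses as moments of the density, and the mean value formula\<close>

theorem theorem5p1:
  fixes a b c d :: real and M N :: nat and P f :: "real \<Rightarrow> real \<Rightarrow> real"
  assumes "a < b" and "c < d"
    and "set_integrable lebesgue ({a..b} \<times> {c..d}) (\<lambda>(y, z). P y z)"
    and "C_class (M + 1) (N + 1) {a..b} {c..d} f"
    and "nabla_convex (M + 1) (N + 1) {a..b} {c..d} f"
    and "\<forall>i\<in>{0..M}. \<forall>j\<in>{0..N}.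
      iter_integral a b c d
        (\<lambda>y z. P y z * ((b - y) ^ i / fact i) * ((d - z) ^ j / fact j)) = 0"
    and "\<forall>j\<in>{0..N}. \<forall>s\<in>{a..b}.
      iter_integral a s c d
        (\<lambda>y z. P y z * ((s - y) ^ M / fact M) * ((d - z) ^ j / fact j)) = 0"
    and "\<forall>i\<in>{0..M}. \<forall>t\<in>{c..d}.
      iter_integral a b c t
        (\<lambda>y z. P y z * ((b - y) ^ i / fact i) * ((t - z) ^ N / fact N)) = 0"
    and "\<forall>s\<in>{a..b}. \<forall>t\<in>{c..d}.
      iter_integral a s c t
        (\<lambda>y z. P y z * ((s - y) ^ M / fact M) * ((t - z) ^ N / fact N)) \<ge> 0"
  shows "\<exists>(\<eta>, \<zeta>) \<in> {a..b} \<times> {c..d}.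
    Lambda a b c d P f =
      (-1) ^ (M + N) * Lambda a b c d P (G0 M N)
        * partial_deriv {a..b} {c..d} f (M + 1) (N + 1) \<eta> \<zeta>"
proof -
  have ab: "a \<le> b" and cd: "c \<le> d" using assms(1,2) by auto
  obtain p :: "real \<times> real \<Rightarrow> real" where p: "integrable lborel p"
    and supp: "\<And>x. x \<notin> {a..b} \<times> {c..d} \<Longrightarrow> p x = 0"
    and density: "\<And>h s t. continuous_on ({a..b} \<times> {c..d}) h \<Longrightarrow> s \<in> {a..b} \<Longrightarrow> t \<in> {c..d} \<Longrightarrow>
      iter_integral a s c t (\<lambda>y z. P y z * h (y, z)) =
        (LINT x|lborel. p x * (indicator ({a..s} \<times> {c..t}) x * h x))"
    using iter_integral_borel_density[OF assms(3)] by blast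
  \<comment> \<open>The cut-off at s and t moves into the integrand \<open>g\<close>. For s = b or t
    = d the cut-off in that variable is void on the rectangle, so \<open>g\<close> keeps the plain
    polynomial there and has a truncated power only in the other variable.\<close>
  have iter: "iter_integral a s c t (\<lambda>y z. P y z * h y z) = (LINT x|lborel. p x * g (fst x) (snd x))"
    if "continuous_on ({a..b} \<times> {c..d}) (\<lambda>x. h (fst x) (snd x))" "s \<in> {a..b}" "t \<in> {c..d}"
      and g: "\<And>y z. y \<in> {a..b} \<Longrightarrow> z \<in> {c..d} \<Longrightarrow> g y z = (if y \<le> s \<and> z \<le> t then h y z else 0)"
    for g h s t
  proof -
    have "p x * (indicator ({a..s} \<times> {c..t}) x * h (fst x) (snd x)) = p x * g (fst x) (snd x)" for x
      using supp[of x] g[of "fst x" "snd x"]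
      by (cases "x \<in> {a..b} \<times> {c..d}") (auto simp: indicator_def mem_Times_iff)
    then show ?thesis using density[OF that(1-3)] by (simp only: fst_conv snd_conv)
  qed
  have poly: "continuous_on A (\<lambda>x. (v - fst x) ^ k / fact k * ((w - snd x) ^ l / fact l))"
    for A :: "(real \<times> real) set" and v w :: real and k l
    by (intro continuous_intros) auto
  define K where "K s t = (LINT x|lborel. p x * (trunc_pow M (fst x) s * trunc_pow N (snd x) t))" for s t
  have poly_poly: "(LINT x|lborel. p x * ((b - fst x) ^ i / fact i * ((d - snd x) ^ j / fact j))) = 0"
    if "i \<le> M" "j \<le> N" for i j
  proof -
    have "iter_integral a b c d (\<lambda>y z. P y z * ((b - y) ^ i / fact i * ((d - z) ^ j / fact j))) = 0"
      using assms(6) that by (simp only: mult.assoc atLeastAtMost_iff) auto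
    then show ?thesis
      using iter[OF poly, of b d "\<lambda>y z. (b - y) ^ i / fact i * ((d - z) ^ j / fact j)"] ab cd
      by simp
  qed
  have trunc_poly: "(LINT x|lborel. p x * (trunc_pow M (fst x) s * ((d - snd x) ^ j / fact j))) = 0"
    if "j \<le> N" "s \<in> {a..b}" for j s
  proof -
    have "iter_integral a s c d (\<lambda>y z. P y z * ((s - y) ^ M / fact M * ((d - z) ^ j / fact j))) = 0"
      using assms(7) that by (simp only: mult.assoc atLeastAtMost_iff) auto
    then show ?thesis
      using iter[OF poly, of s d "\<lambda>y z. trunc_pow M y s * ((d - z) ^ j / fact j)"] that cd
      by (simp add: trunc_pow_def)
  qed
  have poly_trunc: "(LINT x|lborel. p x * ((b - fst x) ^ i / fact i * trunc_pow N (snd x) t)) = 0"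
    if "i \<le> M" "t \<in> {c..d}" for i t
  proof -
    have "iter_integral a b c t (\<lambda>y z. P y z * ((b - y) ^ i / fact i * ((t - z) ^ N / fact N))) = 0"
      using assms(8) that by (simp only: mult.assoc atLeastAtMost_iff) auto
    then show ?thesis
      using iter[OF poly, of b t "\<lambda>y z. (b - y) ^ i / fact i * trunc_pow N z t"] that ab
      by (simp add: trunc_pow_def)
  qed
  have K_nonneg: "0 \<le> K s t" if "s \<in> {a..b}" "t \<in> {c..d}" for s t
  proof -
    have "0 \<le> iter_integral a s c t (\<lambda>y z. P y z * ((s - y) ^ M / fact M * ((t - z) ^ N / fact N)))"
      using assms(9) that by (simp only: mult.assoc)
    then show ?thesis
      using iter[OF poly, of s t "\<lambda>y z. trunc_pow M y s * trunc_pow N z t"] that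
      by (simp add: trunc_pow_def K_def)
  qed
  have [measurable]: "p \<in> borel_measurable borel" using borel_measurable_integrable[OF p] by simp
  have "(\<lambda>z. LINT x|lborel. p x * (trunc_pow M (fst x) (fst z) * trunc_pow N (snd x) (snd z)))
      \<in> borel_measurable borel"
    by measurable
  then have K_meas: "(\<lambda>z. K (fst z) (snd z)) \<in> borel_measurable borel" unfolding K_def .
  define C where "C = (b - a) ^ M / fact M * ((d - c) ^ N / fact N)"
  have K_bnd: "K s t \<le> (LINT x|lborel. \<bar>p x\<bar> * C)" if "s \<in> {a..b}" "t \<in> {c..d}" for s t
    unfolding K_def
  proof (rule integral_mono)
    have w: "\<bar>trunc_pow M (fst x) s * trunc_pow N (snd x) t\<bar> \<le> C" if "p x \<noteq> 0" for x
      unfolding abs_mult C_def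
      using supp[of x] that \<open>s \<in> {a..b}\<close> \<open>t \<in> {c..d}\<close> ab cd
      by (intro mult_mono abs_trunc_pow_le) (auto simp: mem_Times_iff)
    show "integrable lborel (\<lambda>x. p x * (trunc_pow M (fst x) s * trunc_pow N (snd x) t))"
      using w by (intro integrable_mult_bounded_on_support[OF p]) auto
    show "integrable lborel (\<lambda>x. \<bar>p x\<bar> * C)" using p by simp
    show "p x * (trunc_pow M (fst x) s * trunc_pow N (snd x) t) \<le> \<bar>p x\<bar> * C" for x
    proof (cases "p x = 0")
      case False
      have "p x * (trunc_pow M (fst x) s * trunc_pow N (snd x) t) \<le>
          \<bar>p x\<bar> * \<bar>trunc_pow M (fst x) s * trunc_pow N (snd x) t\<bar>"
        unfolding abs_mult[symmetric] by (rule abs_ge_self)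
      also have "\<dots> \<le> \<bar>p x\<bar> * C" using w[OF False] by (intro mult_left_mono) auto
      finally show ?thesis .
    qed simp
  qed
  \<comment> \<open>As a functional of the top derivative \<open>D\<close>, this can be evaluated
    both for \<open>f\<close> and for \<open>G0\<close>; \<open>iterK (\<lambda>s t. 1)\<close> is
    the mass of \<open>K\<close>.\<close>
  define iterK where "iterK D =
    (LINT t|lborel. indicator {c..d} t * (LINT s|lborel. indicator {a..b} s * (K s t * D s t)))"
    for D :: "real \<Rightarrow> real \<Rightarrow> real"
  have Lambda_grid: "Lambda a b c d P h = (-1) ^ (M + N) * iterK (F (M + 1) (N + 1))"
    if F: "derivative_grid a b c d (M + 1) (N + 1) F" and h: "h = F 0 0" for F h
  proof -
    have cont: "continuous_on ({a..b} \<times> {c..d}) (\<lambda>x. F 0 0 (fst x) (snd x))"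
      using F unfolding derivative_grid_def by blast
    have "Lambda a b c d P h = (LINT x|lborel. p x * F 0 0 (fst x) (snd x))"
      unfolding Lambda_def h using iter[OF cont, of b d "F 0 0"] ab cd by simp
    also have "\<dots> = (-1) ^ (M + N) * iterK (F (M + 1) (N + 1))"
      using integral_derivative_grid[OF p supp ab cd _ poly_poly trunc_poly poly_trunc] F
      by (simp add: iterK_def K_def)
    finally show ?thesis .
  qed
  let ?D = "partial_deriv {a..b} {c..d} f (M + 1) (N + 1)"
  have grid: "derivative_grid a b c d (M + 1) (N + 1) (partial_deriv {a..b} {c..d} f)"
    using assms(4) by (rule C_class_derivative_grid)
  then have "continuous_on ({a..b} \<times> {c..d}) (\<lambda>x. ?D (fst x) (snd x))"
    unfolding derivative_grid_def by blast
  from weighted_mean_value_rectangle[OF ab cd this K_meas K_nonneg K_bnd]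
  obtain \<eta> \<zeta> where mean: "\<eta> \<in> {a..b}" "\<zeta> \<in> {c..d}" "iterK ?D = ?D \<eta> \<zeta> * iterK (\<lambda>s t. 1)"
    by (auto simp: iterK_def)
  have f: "Lambda a b c d P f = (-1) ^ (M + N) * iterK ?D"
    using grid by (rule Lambda_grid) (simp add: partial_deriv_def)
  \<comment> \<open>The sign (-1)^(M+N) occurs twice, once from the expansion and once as the top
    derivative of \<open>G0\<close>, and cancels.\<close>
  have "Lambda a b c d P (G0 M N) = (-1) ^ (M + N) * iterK (\<lambda>s t. (-1) ^ (M + N))"
    using Lambda_grid[OF derivative_grid_G0] by (simp add: G0_def[abs_def])
  also have "iterK (\<lambda>s t. (-1) ^ (M + N)) = (-1) ^ (M + N) * iterK (\<lambda>s t. 1)"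
    unfolding iterK_def integral_mult_right_zero[symmetric] by (simp add: mult_ac)
  finally have "Lambda a b c d P (G0 M N) = iterK (\<lambda>s t. 1)"
    by (simp add: power_mult_distrib[symmetric] mult.assoc[symmetric])
  then have "Lambda a b c d P f = (-1) ^ (M + N) * Lambda a b c d P (G0 M N) * ?D \<eta> \<zeta>"
    using f mean(3) by simp
  then show ?thesis using mean(1,2) by blast
qed

end
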